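(* Let $J:\mathbb{N}_0\to\mathbb{R}\cup\{\infty\}$ be an interaction potential with $J(0)=\infty$ and $J(k)\in\mathbb{R}$ for $k\ge1$, and let $y_0=0$, $y_k=e^{-J(k)}$ for $k\ge1$. Let $L\ge2$ and $N\in\{1,\dots,L-1\}$. Consider the totally asymmetric headway exclusion process (TAHEP) with $N$ particles on $\mathbb{T}_L$ with jump rates $w_0=0$, $w_n=w\,e^{J(n+1)-J(n)}$ for $n\ge1$, where $w>0$ is arbitrary. Then its stationary current $j^+_{L,N}$ is $$j^+_{L,N}=w\,\frac{N}{L}\,\frac{\tilde Z^{can}_{N,L-N-1}(\{y\})}{\tilde Z^{can}_{N,L-N}(\{y\})},$$ where, for $N\in\mathbb{N}$ and $K\in\mathbb{N}_0$, $$\tilde Z^{can}_{N,K}(\{y\})=\sum_{\substack{(n_0,\dots,n_{N-1})\in\mathbb{N}_0^N\\ n_0+\dots+n_{N-1}=K}}\ \prod_{i=0}^{N-1}\frac{y_{n_i+1}}{y_1}.$$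
   Context: $\mathbb{N}=\{1,2,\dots\}$, $\mathbb{N}_0=\{0,1,2,\dots\}$, $\mathbb{T}_L=\mathbb{Z}/L\mathbb{Z}$ with sites $0,\dots,L-1$ (indices modulo $L$). Configurations: $\boldsymbol\eta=(\eta_0,\dots,\eta_{L-1})\in\{0,1\}^L$; $\Omega^{can}_{L,N}=\{\boldsymbol\eta\in\{0,1\}^L:\sum_x\eta_x=N\}$. The headway of a particle is the number of empty sites between it and the next particle to its right on the torus; if there is a single particle, its headway is $L-1$. Headway indicator: $h_{x,n}(\boldsymbol\eta)=1$ if $\eta_x=1$ and the headway of the particle at $x$ is $n$, and $0$ otherwise. TAHEP (right jumps, $r=1,\ell=0$) with $N$ particles on $\mathbb{T}_L$: the continuous-time Markov chain on $\Omega^{can}_{L,N}$ with generator $(\mathcal{L}f)(\boldsymbol\eta)=\sum_{x\in\mathbb{T}_L}c_x(\boldsymbol\eta)[f(\boldsymbol\eta^{x,x+1})-f(\boldsymbol\eta)]$, where $c_x(\boldsymbol\eta)=\sum_{n=0}^{L-1}w_nh_{x,n}(\boldsymbol\eta)$ and $\boldsymbol\eta^{x,y}$ is $\boldsymbol\eta$ with the occupation numbers at $x,y$ exchanged. Canonical headway measure: $\mu^{can}_{L,N}(\boldsymbol\eta)=\pi_L(\boldsymbol\eta)/Z^{can}_{L,N}$ on $\Omega^{can}_{L,N}$, with $\pi_L(\boldsymbol\eta)=\prod_{x=0}^{L-1}\prod_{n=0}^{L-1}y_{n+1}^{h_{x,n}(\boldsymbol\eta)}$ and $Z^{can}_{L,N}=\sum_{\boldsymbol\eta\in\Omega^{can}_{L,N}}\pi_L(\boldsymbol\eta)$.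 It is the invariant measure of this TAHEP. The instantaneous current across the bond $(x,x+1)$ is $j^+_x(\boldsymbol\eta)=c_x(\boldsymbol\eta)(\eta_x-\eta_{x+1})=\sum_{n=1}^{L-1}w_nh_{x,n}(\boldsymbol\eta)$; the stationary current $j^+_{L,N}$ is its expectation under $\mu^{can}_{L,N}$, which does not depend on $x$: $j^+_{L,N}=\sum_{n=1}^{L-1}w_n\,\mathbb{E}_{\mu^{can}_{L,N}}[h_{0,n}]$. *)

theory Defs
  imports "HOL-Library.FuncSet" "HOL-Library.Extended_Real"
begin

text \<open>The sites of the torus of length \<open>L\<close> are the naturals below \<open>L\<close>, with neighbours computed modulo
  \<open>L\<close>; configurations are extensional functions on them, so that there are exactly \<open>2 ^ L\<close>.\<close>

type_synonym config = "nat \<Rightarrow> nat"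

definition configs :: "nat \<Rightarrow> nat \<Rightarrow> config set" where
  "configs L N = {\<eta> \<in> {..<L} \<rightarrow>\<^sub>E {0, 1}. (\<Sum>x<L. \<eta> x) = N}"

text \<open>The least \<open>n\<close> below is the number of (empty) sites strictly between \<open>x\<close> and the next particle to
  its right. A single particle is its own next particle, one full turn away, and gets headway
  \<open>L - 1\<close>. Only meaningful if \<open>x\<close> is occupied.\<close>

definition headway :: "nat \<Rightarrow> config \<Rightarrow> nat \<Rightarrow> nat" where
  "headway L \<eta> x = (LEAST n. \<eta> ((x + n + 1) mod L) = 1)"

definition headway_ind :: "nat \<Rightarrow> nat \<Rightarrow> nat \<Rightarrow> config \<Rightarrow> nat" where
  "headway_ind L x n \<eta> = (if \<eta> x = 1 \<and> headway L \<eta> x = n then 1 else 0)"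

definition exchange :: "nat \<Rightarrow> nat \<Rightarrow> config \<Rightarrow> config" where
  "exchange x y \<eta> = \<eta>(x := \<eta> y, y := \<eta> x)"

text \<open>The arguments \<open>r\<close> and \<open>y\<close> below are the rate sequence \<open>(w\<^sub>n)\<close> and the weight sequence \<open>(y\<^sub>k)\<close>.\<close>

definition site_rate :: "(nat \<Rightarrow> real) \<Rightarrow> nat \<Rightarrow> nat \<Rightarrow> config \<Rightarrow> real" where
  "site_rate r L x \<eta> = (\<Sum>n<L. r n * real (headway_ind L x n \<eta>))"

definition tahep_generator ::
    "(nat \<Rightarrow> real) \<Rightarrow> nat \<Rightarrow> (config \<Rightarrow> real) \<Rightarrow> config \<Rightarrow> real" where
  "tahep_generator r L f \<eta> =
     (\<Sum>x<L. site_rate r L x \<eta> * (f (exchange x ((x + 1) mod L) \<eta>) - f \<eta>))"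

definition expect :: "nat \<Rightarrow> nat \<Rightarrow> (config \<Rightarrow> real) \<Rightarrow> (config \<Rightarrow> real) \<Rightarrow> real" where
  "expect L N \<mu> f = (\<Sum>\<eta>\<in>configs L N. \<mu> \<eta> * f \<eta>)"

text \<open>Invariance of a probability mass function on the finite state space, expressed as usual through
  the generator.\<close>

definition tahep_invariant :: "(nat \<Rightarrow> real) \<Rightarrow> nat \<Rightarrow> nat \<Rightarrow> (config \<Rightarrow> real) \<Rightarrow> bool" where
  "tahep_invariant r L N \<mu> \<longleftrightarrow>
     (\<forall>\<eta>\<in>configs L N. 0 \<le> \<mu> \<eta>) \<and> (\<Sum>\<eta>\<in>configs L N. \<mu> \<eta>) = 1 \<and>
     (\<forall>f. expect L N \<mu> (tahep_generator r L f) = 0)"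

definition headway_weight :: "(nat \<Rightarrow> real) \<Rightarrow> nat \<Rightarrow> config \<Rightarrow> real" where
  "headway_weight y L \<eta> = (\<Prod>x<L. \<Prod>n<L. y (n + 1) ^ headway_ind L x n \<eta>)"

definition Z_can :: "(nat \<Rightarrow> real) \<Rightarrow> nat \<Rightarrow> nat \<Rightarrow> real" where
  "Z_can y L N = (\<Sum>\<eta>\<in>configs L N. headway_weight y L \<eta>)"

definition mu_can :: "(nat \<Rightarrow> real) \<Rightarrow> nat \<Rightarrow> nat \<Rightarrow> config \<Rightarrow> real" where
  "mu_can y L N \<eta> = headway_weight y L \<eta> / Z_can y L N"

definition inst_current :: "(nat \<Rightarrow> real) \<Rightarrow> nat \<Rightarrow> nat \<Rightarrow> config \<Rightarrow> real" where
  "inst_current r L x \<eta> = site_rate r L x \<eta> * (real (\<eta> x) - real (\<eta> ((x + 1) mod L)))"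

text \<open>The stationary current across the bond from \<open>x\<close> to \<open>x + 1\<close>.\<close>

definition stationary_current ::
    "(nat \<Rightarrow> real) \<Rightarrow> (nat \<Rightarrow> real) \<Rightarrow> nat \<Rightarrow> nat \<Rightarrow> nat \<Rightarrow> real" where
  "stationary_current r y L N x = expect L N (mu_can y L N) (inst_current r L x)"

text \<open>The potential takes values in the reals and infinity; \<open>y\<^sub>k = exp (- J k)\<close>, with
  \<open>exp (- \<infinity>) = 0\<close>.\<close>

definition boltzmann :: "(nat \<Rightarrow> ereal) \<Rightarrow> nat \<Rightarrow> real" where
  "boltzmann J k = (if J k = \<infinity> then 0 else exp (- real_of_ereal (J k)))"

definition jump_rate :: "(nat \<Rightarrow> ereal) \<Rightarrow> real \<Rightarrow> nat \<Rightarrow> real" where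
  "jump_rate J w n = (if n = 0 then 0 else w * exp (real_of_ereal (J (n + 1) - J n)))"

text \<open>Tuples \<open>(n\<^sub>0, \<dots>, n\<^bsub>N-1\<^esub>)\<close> are lists of length \<open>N\<close>; the index set is finite.\<close>

definition Z_tilde :: "(nat \<Rightarrow> real) \<Rightarrow> nat \<Rightarrow> nat \<Rightarrow> real" where
  "Z_tilde y N K =
     (\<Sum>ns\<in>{ns :: nat list. length ns = N \<and> sum_list ns = K}. \<Prod>i<N. y (ns ! i + 1) / y 1)"

end

theory Submission
  imports Defs
begin

text \<open>
  Summing over all bonds and using translation covariance, both claims become statements about
  configurations with a particle at \<open>0\<close>. These are encoded by the list of their headways
  \<open>n\<^sub>0, \<dots>, n\<^bsub>N-1\<^esub>\<close> with sum \<open>L - N\<close>, and their weight is the product of the \<open>y\<^bsub>n\<^sub>i+1\<^esub>\<close>. Since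
  \<open>w\<^sub>n y\<^bsub>n+1\<^esub> = w y\<^sub>n\<close>, multiplying the weight by the jump rate of the particle at \<open>0\<close> amounts
  to decrementing \<open>n\<^sub>0\<close>, so the current is a sum of weights over lists with sum \<open>L - N - 1\<close>. A jump
  of that particle afterwards increments the last headway instead of the first one; as the weight
  is symmetric, the gain and loss terms of the generator agree after a cyclic shift of the list,
  which is the invariance.
\<close>

text \<open>The particle at site \<open>a\<close> moves to site \<open>0\<close>. Restricting to the
  sites keeps the result extensional, hence inside \<open>configs\<close>.\<close>

definition translate :: "nat \<Rightarrow> nat \<Rightarrow> config \<Rightarrow> config" where
  "translate L a \<eta> = (\<lambda>i\<in>{..<L}. \<eta> ((i + a) mod L))"

definition of_bits :: "nat list \<Rightarrow> config" where
  "of_bits bs = (\<lambda>i\<in>{..<length bs}. bs ! i)"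

text \<open>Each headway becomes one block, a particle followed by its empty sites, so a nonempty
  list always starts with an occupied site.\<close>

definition gap_bits :: "nat list \<Rightarrow> nat list" where
  "gap_bits ns = concat (map (\<lambda>n. 1 # replicate n 0) ns)"

definition gap_lists :: "nat \<Rightarrow> nat \<Rightarrow> nat list set" where
  "gap_lists N K = {ns. length ns = N \<and> sum_list ns = K}"

text \<open>The summand of \<open>Z_tilde\<close> without the normalisation by
  \<open>y 1\<close>.\<close>

definition gap_weight :: "(nat \<Rightarrow> real) \<Rightarrow> nat list \<Rightarrow> real" where
  "gap_weight y ns = prod_list (map (\<lambda>n. y (n + 1)) ns)"

subsection \<open>Translations of the torus\<close>

text \<open>Congruent sums force \<open>L\<close> to divide \<open>j - i\<close>, a natural number
  below \<open>L\<close>.\<close>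

lemma add_mod_inj:
  fixes L a i j :: nat
  assumes "i < L" "j < L" "(i + a) mod L = (j + a) mod L"
  shows "i = j"
  using assms
proof (induction i j rule: linorder_wlog)
  case (le i j)
  then have "L dvd j - i"
    using mod_eq_dvd_iff_nat[of "i + a" "j + a" L] by simp
  then show ?case
    using le by (auto dest: dvd_imp_le)
qed simp

lemma bij_betw_add_mod: "bij_betw (\<lambda>i. (i + a) mod L) {..<L} {..<(L::nat)}"
proof -
  have "inj_on (\<lambda>i. (i + a) mod L) {..<L}"
    by (auto intro: inj_onI add_mod_inj)
  moreover have "(\<lambda>i. (i + a) mod L) ` {..<L} \<subseteq> {..<L}"
    by (auto simp: gr_implies_not0)
  ultimately show ?thesis
    by (intro bij_betw_imageI endo_inj_surj) auto
qed

lemma sum_add_mod: "(\<Sum>i<L. g ((i + a) mod L)) = (\<Sum>i<L. g i)" for L :: nat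
  using sum.reindex_bij_betw[OF bij_betw_add_mod, where g = g] .

lemma prod_add_mod: "(\<Prod>i<L. g ((i + a) mod L)) = (\<Prod>i<L. g i)" for L :: nat
  using prod.reindex_bij_betw[OF bij_betw_add_mod, where g = g] .

lemma translate_apply [simp]: "i < L \<Longrightarrow> translate L a \<eta> i = \<eta> ((i + a) mod L)"
  by (simp add: translate_def)

lemma translate_mod: "translate L (a mod L) \<eta> = translate L a \<eta>"
  by (simp add: translate_def mod_add_right_eq)

lemma translate_translate: "translate L a (translate L b \<eta>) = translate L (a + b) \<eta>"
proof
  fix i
  show "translate L a (translate L b \<eta>) i = translate L (a + b) \<eta> i"
    by (cases "i < L") (auto simp: translate_def mod_add_left_eq add.assoc)
qed

lemma translate_L:
  assumes "\<eta> \<in> extensional {..<L}"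
  shows "translate L L \<eta> = \<eta>"
proof
  fix i
  show "translate L L \<eta> i = \<eta> i"
    using extensional_arb[OF assms, of i] by (cases "i < L") (simp_all add: translate_def)
qed

lemma configs_extensional: "\<eta> \<in> configs L N \<Longrightarrow> \<eta> \<in> extensional {..<L}"
  by (simp add: configs_def PiE_def)

lemma configs_le_1: "\<eta> \<in> configs L N \<Longrightarrow> i < L \<Longrightarrow> \<eta> i = 0 \<or> \<eta> i = 1"
  by (auto simp: configs_def)

lemma finite_configs: "finite (configs L N)"
  unfolding configs_def by (rule finite_subset[of _ "{..<L} \<rightarrow>\<^sub>E {0, 1}"]) (auto intro: finite_PiE)

lemma translate_in_configs:
  assumes "\<eta> \<in> configs L N"
  shows "translate L a \<eta> \<in> configs L N"
proof -
  have "\<eta> ((x + a) mod L) \<in> {0, 1}" if "x < L" for x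
    using configs_le_1[OF assms, of "(x + a) mod L"] that by auto
  then have "translate L a \<eta> \<in> {..<L} \<rightarrow>\<^sub>E {0, 1}"
    unfolding translate_def by (intro restrict_PiE[THEN iffD2] funcsetI) auto
  moreover have "(\<Sum>x<L. translate L a \<eta> x) = (\<Sum>x<L. \<eta> x)"
    by (simp add: sum_add_mod)
  ultimately show ?thesis
    using assms by (simp add: configs_def)
qed

text \<open>The inverse is translation by \<open>L - a\<close>, a genuine difference as
  \<open>a \<le> L\<close>; together they turn once around the torus, which fixes extensional
  functions.\<close>

lemma bij_betw_translate:
  assumes "a \<le> L"
  shows "bij_betw (translate L a) (configs L N) (configs L N)"
  by (rule bij_betw_byWitness[where f' = "translate L (L - a)"])
    (use assms in \<open>auto simp: translate_translate translate_L configs_extensional translate_in_configs\<close>)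

lemma sum_configs_translate:
  "a \<le> L \<Longrightarrow> (\<Sum>\<eta>\<in>configs L N. g (translate L a \<eta>)) = (\<Sum>\<eta>\<in>configs L N. g \<eta>)"
  by (rule sum.reindex_bij_betw[OF bij_betw_translate])

lemma headway_translate:
  assumes "i < L"
  shows "headway L (translate L a \<eta>) i = headway L \<eta> ((i + a) mod L)"
proof -
  have "((i + n + 1) mod L + a) mod L = ((i + a) mod L + n + 1) mod L" for n
    by (metis (no_types, opaque_lifting) add.assoc add.commute mod_add_left_eq)
  then show ?thesis
    using assms by (simp add: headway_def)
qed

lemma headway_ind_translate:
  "i < L \<Longrightarrow> headway_ind L i n (translate L a \<eta>) = headway_ind L ((i + a) mod L) n \<eta>"
  by (simp add: headway_ind_def headway_translate)

lemma site_rate_translate: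
  "i < L \<Longrightarrow> site_rate r L i (translate L a \<eta>) = site_rate r L ((i + a) mod L) \<eta>"
  by (simp add: site_rate_def headway_ind_translate)

lemma headway_weight_translate:
  "headway_weight y L (translate L a \<eta>) = headway_weight y L \<eta>"
proof -
  have "headway_weight y L (translate L a \<eta>)
      = (\<Prod>x<L. \<Prod>n<L. y (n + 1) ^ headway_ind L ((x + a) mod L) n \<eta>)"
    unfolding headway_weight_def by (intro prod.cong) (auto simp: headway_ind_translate)
  also have "\<dots> = headway_weight y L \<eta>"
    unfolding headway_weight_def
    by (rule prod_add_mod[where g = "\<lambda>x. \<Prod>n<L. y (n + 1) ^ headway_ind L x n \<eta>"])
  finally show ?thesis .
qed

lemma exchange_translate:
  assumes "L \<ge> 2" "x < L"
  shows "exchange 0 1 (translate L x \<eta>) = translate L x (exchange x ((x + 1) mod L) \<eta>)"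
proof
  fix i
  have *: "(i + x) mod L = x \<longleftrightarrow> i = 0" "(i + x) mod L = (1 + x) mod L \<longleftrightarrow> i = 1" if "i < L"
    using add_mod_inj[of i L 0 x] add_mod_inj[of i L 1 x] that assms by auto
  show "exchange 0 1 (translate L x \<eta>) i = translate L x (exchange x ((x + 1) mod L) \<eta>) i"
  proof (cases "i < L")
    case True
    then show ?thesis
      using * assms by (auto simp: exchange_def)
  next
    case False
    then show ?thesis using assms by (auto simp: exchange_def translate_def)
  qed
qed

section \<open>Rates, weights and currents in terms of the headway\<close>

lemma headway_less:
  assumes "\<eta> x = 1" "x < L"
  shows "headway L \<eta> x < L"
proof -
  have "headway L \<eta> x \<le> L - 1"
    \<comment> \<open>The candidate \<open>L - 1\<close> leads once around the torus, back to the
      occupied site \<open>x\<close>.\<close>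
    unfolding headway_def by (rule Least_le) (use assms in auto)
  then show ?thesis using assms by simp
qed

lemma site_rate_eq:
  assumes "x < L"
  shows "site_rate r L x \<eta> = (if \<eta> x = 1 then r (headway L \<eta> x) else 0)"
proof (cases "\<eta> x = 1")
  case True
  have "site_rate r L x \<eta> = (\<Sum>n<L. if headway L \<eta> x = n then r n else 0)"
    unfolding site_rate_def by (intro sum.cong) (auto simp: headway_ind_def True)
  then show ?thesis using headway_less[of \<eta> x L] True assms by simp
qed (simp add: site_rate_def headway_ind_def)

lemma headway_weight_eq:
  "headway_weight y L \<eta> = (\<Prod>x<L. if \<eta> x = 1 then y (headway L \<eta> x + 1) else 1)"
  unfolding headway_weight_def
proof (intro prod.cong refl)
  fix x assume "x \<in> {..<L}"
  show "(\<Prod>n<L. y (n + 1) ^ headway_ind L x n \<eta>) = (if \<eta> x = 1 then y (headway L \<eta> x + 1) else 1)"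
  proof (cases "\<eta> x = 1")
    case True
    have "(\<Prod>n<L. y (n + 1) ^ headway_ind L x n \<eta>)
        = (\<Prod>n<L. if headway L \<eta> x = n then y (n + 1) else 1)"
      by (intro prod.cong) (auto simp: headway_ind_def True)
    then show ?thesis using headway_less[of \<eta> x L] True \<open>x \<in> _\<close> by simp
  qed (simp add: headway_ind_def)
qed

text \<open>If the right neighbour is occupied, the headway is \<open>0\<close> and the rate
  vanishes; otherwise the occupation difference is \<open>1\<close> wherever the rate is
  nonzero.\<close>

lemma inst_current_eq:
  assumes "x < L" "r 0 = 0" "\<eta> \<in> configs L N"
  shows "inst_current r L x \<eta> = site_rate r L x \<eta>"
proof (cases "\<eta> ((x + 1) mod L) = 1")
  case True
  then have "headway L \<eta> x = 0" by (simp add: headway_def)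
  then show ?thesis using assms by (simp add: inst_current_def site_rate_eq)
next
  case False
  then have "\<eta> ((x + 1) mod L) = 0"
    using assms configs_le_1[OF assms(3)] by (metis gr_implies_not0 mod_less_divisor neq0_conv)
  then show ?thesis using assms by (simp add: inst_current_def site_rate_eq)
qed

subsection \<open>Configurations as gap lists\<close>

lemma of_bits_apply [simp]: "i < length bs \<Longrightarrow> of_bits bs i = bs ! i"
  by (simp add: of_bits_def)

lemma inj_of_bits: "length bs = length cs \<Longrightarrow> of_bits bs = of_bits cs \<Longrightarrow> bs = cs"
  by (rule nth_equalityI) (auto dest: fun_cong simp: of_bits_def restrict_def split: if_splits)

text \<open>Turns translations of the torus into list rotations, so that cyclic shifts can be
  computed on blocks of bits.\<close>

lemma translate_of_bits:
  "translate (length bs) a (of_bits bs) = of_bits (rotate a bs)"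
proof
  fix i
  show "translate (length bs) a (of_bits bs) i = of_bits (rotate a bs) i"
    by (cases "i < length bs", cases "bs = []") (auto simp: translate_def nth_rotate add.commute of_bits_def)
qed

lemma exchange_of_bits: "exchange 0 1 (of_bits (a # b # bs)) = of_bits (b # a # bs)"
  by (auto simp: fun_eq_iff exchange_def of_bits_def nth_Cons split: nat.splits)

lemma of_bits_in_configs:
  assumes "set bs \<subseteq> {0, 1}"
  shows "of_bits bs \<in> configs (length bs) (sum_list bs)"
proof -
  have "(\<Sum>x<length bs. of_bits bs x) = sum_list bs"
    by (simp add: sum.list_conv_set_nth atLeast0LessThan)
  then show ?thesis
    using assms by (auto simp: configs_def of_bits_def Pi_def subset_iff)
qed

lemma config_eq_of_bits:
  assumes "\<eta> \<in> configs L N"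
  obtains bs where "\<eta> = of_bits bs" "length bs = L" "set bs \<subseteq> {0, 1}" "sum_list bs = N"
proof
  have \<eta>: "\<eta> \<in> {..<L} \<rightarrow>\<^sub>E {0, 1}" and N: "(\<Sum>x<L. \<eta> x) = N"
    using assms by (simp_all add: configs_def)
  show "\<eta> = of_bits (map \<eta> [0..<L])"
  proof
    fix i
    show "\<eta> i = of_bits (map \<eta> [0..<L]) i"
      using PiE_arb[OF \<eta>, of i] by (cases "i < L") (simp_all add: of_bits_def)
  qed
  show "set (map \<eta> [0..<L]) \<subseteq> {0, 1}"
    using PiE_mem[OF \<eta>] by fastforce
  show "sum_list (map \<eta> [0..<L]) = N"
    using N by (simp add: interv_sum_list_conv_sum_set_nat atLeast0LessThan)
qed simp

lemma gap_bits_Nil [simp]: "gap_bits [] = []"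
  and gap_bits_Cons: "gap_bits (n # ns) = 1 # replicate n 0 @ gap_bits ns"
  and gap_bits_append: "gap_bits (ns @ ms) = gap_bits ns @ gap_bits ms"
  by (simp_all add: gap_bits_def)

lemma length_gap_bits: "length (gap_bits ns) = length ns + sum_list ns"
  by (induction ns) (auto simp: gap_bits_Cons)

lemma sum_list_gap_bits: "sum_list (gap_bits ns) = length ns"
  by (induction ns) (auto simp: gap_bits_Cons sum_list_replicate)

lemma set_gap_bits: "set (gap_bits ns) \<subseteq> {0, 1}"
  by (induction ns) (auto simp: gap_bits_Cons)

lemma takeWhile_gap_bits: "takeWhile (\<lambda>b. b = 0) (replicate n 0 @ gap_bits ns) = replicate n 0"
proof -
  have "takeWhile (\<lambda>b. b = 0) (gap_bits ns) = []"
    by (cases ns) (auto simp: gap_bits_Cons)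
  then show ?thesis by (simp add: takeWhile_append)
qed

text \<open>The zeros after the initial particle end where the next block starts, so counting them
  recovers the first headway.\<close>

lemma inj_gap_bits: "gap_bits ns = gap_bits ms \<Longrightarrow> ns = ms"
proof (induction ns arbitrary: ms)
  case Nil
  then show ?case by (cases ms) (auto simp: gap_bits_Cons)
next
  case (Cons n ns)
  then obtain m ms' where ms: "ms = m # ms'" by (cases ms) (auto simp: gap_bits_Cons)
  have eq: "replicate n 0 @ gap_bits ns = replicate m 0 @ gap_bits ms'"
    using Cons.prems by (simp add: ms gap_bits_Cons)
  then have "n = m"
    using takeWhile_gap_bits by (metis length_replicate)
  with eq Cons.IH ms show ?case by simp
qed

text \<open>The \<open>n\<close> zeros in front precede the first particle; there are none once site
  \<open>0\<close> is occupied.\<close>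

lemma ex_gap_bits: "set bs \<subseteq> {0, 1} \<Longrightarrow> \<exists>n ns. bs = replicate n 0 @ gap_bits ns"
proof (induction bs)
  case Nil
  have "[] = replicate 0 0 @ gap_bits []" by simp
  then show ?case by blast
next
  case (Cons b bs)
  then obtain n ns where bs: "bs = replicate n 0 @ gap_bits ns" by auto
  have "b # bs = replicate (Suc n) 0 @ gap_bits ns" if "b = 0" using that bs by simp
  moreover have "b # bs = replicate 0 0 @ gap_bits (n # ns)" if "b = 1"
    using that bs by (simp add: gap_bits_Cons)
  ultimately show ?case using Cons.prems by (metis insertCI insert_iff list.set_intros(1) singletonD subsetD)
qed

text \<open>Cutting the torus just before the occupied site \<open>0\<close> splits the
  configuration into blocks, one per particle. The headways add up to the number
  \<open>L - N\<close> of empty sites.\<close>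

lemma bij_betw_gap_lists:
  assumes "1 \<le> N" "N \<le> L"
  shows "bij_betw (\<lambda>ns. of_bits (gap_bits ns)) (gap_lists N (L - N)) {\<eta> \<in> configs L N. \<eta> 0 = 1}"
proof (rule bij_betw_imageI)
  have len: "length (gap_bits ns) = L" if "ns \<in> gap_lists N (L - N)" for ns
    using that assms by (simp add: length_gap_bits gap_lists_def)
  show "inj_on (\<lambda>ns. of_bits (gap_bits ns)) (gap_lists N (L - N))"
    by (rule inj_onI) (metis inj_gap_bits inj_of_bits len)
  show "(\<lambda>ns. of_bits (gap_bits ns)) ` gap_lists N (L - N) = {\<eta> \<in> configs L N. \<eta> 0 = 1}"
  proof (intro equalityI subsetI)
    fix \<eta> assume "\<eta> \<in> (\<lambda>ns. of_bits (gap_bits ns)) ` gap_lists N (L - N)"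
    then obtain ns where ns: "ns \<in> gap_lists N (L - N)" and \<eta>: "\<eta> = of_bits (gap_bits ns)" by auto
    have "\<eta> \<in> configs L N"
      using of_bits_in_configs[OF set_gap_bits, of ns] len[OF ns] ns
      by (simp add: \<eta> sum_list_gap_bits gap_lists_def)
    moreover have "\<eta> 0 = 1"
      using ns assms by (cases ns) (auto simp: \<eta> gap_bits_Cons gap_lists_def)
    ultimately show "\<eta> \<in> {\<eta> \<in> configs L N. \<eta> 0 = 1}" by simp
  next
    fix \<eta> assume "\<eta> \<in> {\<eta> \<in> configs L N. \<eta> 0 = 1}"
    then have \<eta>: "\<eta> \<in> configs L N" "\<eta> 0 = 1" by auto
    from config_eq_of_bits[OF \<eta>(1)] obtain bs
      where bs: "\<eta> = of_bits bs" "length bs = L" "set bs \<subseteq> {0, 1}" "sum_list bs = N" .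
    obtain n ns where eq: "bs = replicate n 0 @ gap_bits ns" using ex_gap_bits[OF bs(3)] by auto
    have "bs ! 0 = 1" using \<eta>(2) bs assms by simp
    then have "n = 0"
      using bs(2) assms eq by (cases n) auto
    then have eq: "bs = gap_bits ns" using eq by simp
    then have "length ns = N" "length ns + sum_list ns = L"
      using bs sum_list_gap_bits[of ns] length_gap_bits[of ns] by auto
    then have "ns \<in> gap_lists N (L - N)" by (simp add: gap_lists_def)
    then show "\<eta> \<in> (\<lambda>ns. of_bits (gap_bits ns)) ` gap_lists N (L - N)"
      using bs(1) eq by auto
  qed
qed

text \<open>As site \<open>0\<close> is occupied, the search to the right of \<open>x\<close> stops
  at the latest at the end of the list, where the index wraps around to \<open>0\<close>. Headways
  can thus be read off without the modulus.\<close>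

lemma headway_of_bits:
  assumes "length bs = L" "bs \<noteq> []" "bs ! 0 = 1" "set bs \<subseteq> {0, 1}" "x < L"
  shows "headway L (of_bits bs) x = length (takeWhile (\<lambda>b. b = 0) (drop (Suc x) bs))"
    (is "_ = length (takeWhile _ ?ds)")
proof -
  let ?n = "length (takeWhile (\<lambda>b. b = 0) ?ds)"
  have le: "?n \<le> L - Suc x" using length_takeWhile_le[of "\<lambda>b. b = 0" ?ds] assms by simp
  have occ: "of_bits bs ((x + ?n + 1) mod L) = 1"
  proof (cases "?n = L - Suc x")
    \<comment> \<open>No particle lies between \<open>x\<close> and the end of the list: the index
      is exactly \<open>L\<close>, that is, site \<open>0\<close>.\<close>
    case True
    then have "x + ?n + 1 = L" using assms by simp
    then show ?thesis using assms by simp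
  next
    case False
    with le have lt: "?n < length ?ds" using assms by simp
    then have "?ds ! ?n \<noteq> 0" using nth_length_takeWhile by blast
    moreover have "?ds ! ?n = bs ! (x + ?n + 1)" and "x + ?n + 1 < L" using lt assms by auto
    moreover have "bs ! (x + ?n + 1) \<in> {0, 1}"
      using assms calculation nth_mem by blast
    ultimately show ?thesis using assms by simp
  qed
  have empty: "?n \<le> m" if "of_bits bs ((x + m + 1) mod L) = 1" for m
  proof (rule ccontr)
    assume "\<not> ?n \<le> m"
    then have m: "m < ?n" by simp
    then have "x + m + 1 < L" using le by simp
    moreover have "?ds ! m = 0"
      using m by (metis (mono_tags) nth_mem set_takeWhileD takeWhile_nth)
    ultimately show False using that assms by simp
  qed
  show ?thesis
    unfolding headway_def using occ empty by (rule Least_equality)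
qed

text \<open>Induction peels off the first block: its particle contributes the factor of its headway,
  its empty sites contribute \<open>1\<close>.\<close>

lemma prod_takeWhile_gap_bits:
  "(\<Prod>x<length (gap_bits ns). if gap_bits ns ! x = 1
      then y (length (takeWhile (\<lambda>b. b = 0) (drop (Suc x) (gap_bits ns))) + 1) else 1)
    = gap_weight y ns" (is "?P ns = _")
proof (induction ns)
  case Nil
  then show ?case by (simp add: gap_weight_def)
next
  case (Cons n ns)
  let ?f = "\<lambda>(bs :: nat list) x. if bs ! x = 1 then y (length (takeWhile (\<lambda>b. b = 0) (drop (Suc x) bs)) + 1) else (1::real)"
  \<comment> \<open>A zero put in front contributes \<open>1\<close>, and all other factors look
    only to their right, so they are merely reindexed.\<close>
  have skip: "(\<Prod>x<length (replicate n 0 @ gap_bits ns). ?f (replicate n 0 @ gap_bits ns) x)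
      = (\<Prod>x<length (gap_bits ns). ?f (gap_bits ns) x)"
  proof (induction n)
    case (Suc n)
    have "(\<Prod>x<length (0 # bs). ?f (0 # bs) x) = (\<Prod>x<length bs. ?f bs x)" for bs
      by (simp add: prod.lessThan_Suc_shift del: prod.lessThan_Suc cong: if_cong)
    from this[of "replicate n 0 @ gap_bits ns"] Suc show ?case
      by (simp only: replicate_Suc append_Cons)
  qed (simp cong: if_cong)
  have "?P (n # ns) = y (length (takeWhile (\<lambda>b. b = 0) (replicate n 0 @ gap_bits ns)) + 1)
      * (\<Prod>x<length (replicate n 0 @ gap_bits ns). ?f (replicate n 0 @ gap_bits ns) x)"
    by (simp add: gap_bits_Cons prod.lessThan_Suc_shift del: prod.lessThan_Suc cong: if_cong)
  also have "\<dots> = gap_weight y (n # ns)"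
    unfolding skip Cons.IH takeWhile_gap_bits by (simp add: gap_weight_def)
  finally show ?case .
qed

lemma headway_weight_gap_bits:
  assumes "ns \<in> gap_lists N (L - N)" "1 \<le> N" "N \<le> L"
  shows "headway_weight y L (of_bits (gap_bits ns)) = gap_weight y ns"
proof -
  have len: "length (gap_bits ns) = L"
    using assms by (simp add: length_gap_bits gap_lists_def)
  obtain m ms where ns: "ns = m # ms"
    using assms by (cases ns) (auto simp: gap_lists_def)
  have hd: "gap_bits ns \<noteq> []" "gap_bits ns ! 0 = 1" by (simp_all add: ns gap_bits_Cons)
  have "headway_weight y L (of_bits (gap_bits ns)) = (\<Prod>x<length (gap_bits ns). if gap_bits ns ! x = 1
      then y (length (takeWhile (\<lambda>b. b = 0) (drop (Suc x) (gap_bits ns))) + 1) else 1)"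
    unfolding headway_weight_eq len
    by (intro prod.cong) (auto simp: headway_of_bits[OF len hd set_gap_bits] len)
  then show ?thesis by (simp only: prod_takeWhile_gap_bits)
qed

lemma headway_gap_bits_0:
  assumes "ns \<in> gap_lists N (L - N)" "1 \<le> N" "N \<le> L"
  shows "headway L (of_bits (gap_bits ns)) 0 = hd ns"
proof -
  have len: "length (gap_bits ns) = L"
    using assms by (simp add: length_gap_bits gap_lists_def)
  obtain m ms where ns: "ns = m # ms"
    using assms by (cases ns) (auto simp: gap_lists_def)
  show ?thesis
    by (subst headway_of_bits[OF len])
      (use assms set_gap_bits[of ns] in \<open>auto simp: ns gap_bits_Cons takeWhile_gap_bits\<close>)
qed

section \<open>From sums over configurations to sums over gap lists\<close>

lemma sum_configs_occupied_0:
  assumes "1 \<le> N" "N \<le> L"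
  shows "(\<Sum>\<eta>\<in>configs L N. if \<eta> 0 = 1 then g \<eta> else 0)
    = (\<Sum>ns\<in>gap_lists N (L - N). g (of_bits (gap_bits ns)))"
proof -
  have "(\<Sum>\<eta>\<in>configs L N. if \<eta> 0 = 1 then g \<eta> else 0) = sum g {\<eta> \<in> configs L N. \<eta> 0 = 1}"
    by (rule sum.inter_filter[OF finite_configs, symmetric])
  then show ?thesis
    by (simp only: sum.reindex_bij_betw[OF bij_betw_gap_lists[OF assms]])
qed

text \<open>Only configurations with a particle at \<open>0\<close> contribute, and its headway is
  the head of the list. The factor \<open>g\<close> is \<open>1\<close> for the current and an orbit
  sum for the generator.\<close>

lemma sum_configs_site_rate:
  assumes "1 \<le> N" "N \<le> L"
  shows "(\<Sum>\<eta>\<in>configs L N. headway_weight y L \<eta> * site_rate r L 0 \<eta> * g \<eta>)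
    = (\<Sum>ns\<in>gap_lists N (L - N). gap_weight y ns * r (hd ns) * g (of_bits (gap_bits ns)))"
proof -
  have "(\<Sum>\<eta>\<in>configs L N. headway_weight y L \<eta> * site_rate r L 0 \<eta> * g \<eta>)
      = (\<Sum>\<eta>\<in>configs L N. if \<eta> 0 = 1 then headway_weight y L \<eta> * r (headway L \<eta> 0) * g \<eta> else 0)"
    using assms by (intro sum.cong) (auto simp: site_rate_eq)
  also have "\<dots> = (\<Sum>ns\<in>gap_lists N (L - N). gap_weight y ns * r (hd ns) * g (of_bits (gap_bits ns)))"
    unfolding sum_configs_occupied_0[OF assms]
    using assms by (intro sum.cong) (simp_all add: headway_weight_gap_bits headway_gap_bits_0)
  finally show ?thesis .
qed

lemma sum_configs_site_rate_eq_0: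
  assumes "x < L"
  shows "(\<Sum>\<eta>\<in>configs L N. headway_weight y L \<eta> * site_rate r L x \<eta>)
    = (\<Sum>\<eta>\<in>configs L N. headway_weight y L \<eta> * site_rate r L 0 \<eta>)"
  using sum_configs_translate[of x L "\<lambda>\<eta>. headway_weight y L \<eta> * site_rate r L 0 \<eta>" N] assms
  by (simp add: headway_weight_translate site_rate_translate)

lemma finite_gap_lists: "finite (gap_lists N K)"
proof (rule finite_subset)
  show "gap_lists N K \<subseteq> {ns. set ns \<subseteq> {..K} \<and> length ns = N}"
    by (auto simp: gap_lists_def dest: member_le_sum_list)
qed (simp add: finite_lists_length_eq)

lemma gap_weight_Cons: "gap_weight y (n # ns) = y (n + 1) * gap_weight y ns"
  by (simp add: gap_weight_def)

text \<open>The normalisation is the same power of \<open>y 1\<close> for every list of length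
  \<open>N\<close>, so it cancels in quotients.\<close>

lemma Z_tilde_eq: "Z_tilde y N K = (\<Sum>ns\<in>gap_lists N K. gap_weight y ns) / y 1 ^ N"
proof -
  have "(\<Prod>i<N. y (ns ! i + 1) / y 1) = gap_weight y ns / y 1 ^ N" if "ns \<in> gap_lists N K" for ns
    using that
    by (simp add: gap_lists_def gap_weight_def prod.list_conv_set_nth prod_dividef atLeast0LessThan)
  then show ?thesis
    by (simp add: Z_tilde_def sum_divide_distrib flip: gap_lists_def)
qed

text \<open>Double counting of the pairs of a configuration and one of its particles.\<close>

lemma N_times_Z_can:
  assumes "1 \<le> N" "N \<le> L"
  shows "real N * Z_can y L N = real L * (\<Sum>ns\<in>gap_lists N (L - N). gap_weight y ns)"
proof -
  have "real N * Z_can y L N = (\<Sum>\<eta>\<in>configs L N. (\<Sum>x<L. real (\<eta> x)) * headway_weight y L \<eta>)"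
    unfolding Z_can_def sum_distrib_left
  proof (rule sum.cong[OF refl])
    fix \<eta> assume "\<eta> \<in> configs L N"
    then have "real (\<Sum>x<L. \<eta> x) = real N"
      by (simp only: configs_def mem_Collect_eq)
    then show "real N * headway_weight y L \<eta> = (\<Sum>x<L. real (\<eta> x)) * headway_weight y L \<eta>"
      by simp
  qed
  also have "\<dots> = (\<Sum>x<L. \<Sum>\<eta>\<in>configs L N. real (\<eta> x) * headway_weight y L \<eta>)"
    unfolding sum_distrib_right by (rule sum.swap)
  \<comment> \<open>Translation by \<open>x\<close> moves site \<open>x\<close> to \<open>0\<close>
    and preserves the weight, so every site contributes equally.\<close>
  also have "\<dots> = (\<Sum>x<L. \<Sum>\<eta>\<in>configs L N. real (\<eta> 0) * headway_weight y L \<eta>)"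
  proof (rule sum.cong[OF refl])
    fix x assume "x \<in> {..<L}"
    then show "(\<Sum>\<eta>\<in>configs L N. real (\<eta> x) * headway_weight y L \<eta>)
        = (\<Sum>\<eta>\<in>configs L N. real (\<eta> 0) * headway_weight y L \<eta>)"
      using sum_configs_translate[of x L "\<lambda>\<eta>. real (\<eta> 0) * headway_weight y L \<eta>" N]
      by (simp add: headway_weight_translate)
  qed
  also have "(\<Sum>\<eta>\<in>configs L N. real (\<eta> 0) * headway_weight y L \<eta>)
      = (\<Sum>\<eta>\<in>configs L N. if \<eta> 0 = 1 then headway_weight y L \<eta> else 0)"
  proof (rule sum.cong[OF refl])
    fix \<eta> assume "\<eta> \<in> configs L N"
    then have "\<eta> 0 = 0 \<or> \<eta> 0 = 1"
      using configs_le_1 assms by auto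
    then show "real (\<eta> 0) * headway_weight y L \<eta> = (if \<eta> 0 = 1 then headway_weight y L \<eta> else 0)"
      by auto
  qed
  also have "\<dots> = (\<Sum>ns\<in>gap_lists N (L - N). gap_weight y ns)"
    unfolding sum_configs_occupied_0[OF assms]
    using assms by (intro sum.cong) (simp_all add: headway_weight_gap_bits)
  finally show ?thesis by simp
qed

subsection \<open>Invariance and stationary current\<close>

text \<open>A translation-invariant substitute for \<open>f\<close>, counting periodic
  configurations with multiplicity. It lets the sum over all bonds be replaced by the single bond
  from \<open>0\<close> to \<open>1\<close>.\<close>

definition orbit_sum :: "nat \<Rightarrow> (config \<Rightarrow> real) \<Rightarrow> config \<Rightarrow> real" where
  "orbit_sum L f \<eta> = (\<Sum>x<L. f (translate L x \<eta>))"

lemma orbit_sum_translate: "orbit_sum L f (translate L a \<eta>) = orbit_sum L f \<eta>"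
proof -
  have "orbit_sum L f (translate L a \<eta>) = (\<Sum>x<L. f (translate L ((x + a) mod L) \<eta>))"
    by (simp add: orbit_sum_def translate_translate translate_mod)
  also have "\<dots> = orbit_sum L f \<eta>"
    unfolding orbit_sum_def by (rule sum_add_mod[where g = "\<lambda>x. f (translate L x \<eta>)"])
  finally show ?thesis .
qed

lemma orbit_sum_of_bits:
  "length (bs @ cs) = L \<Longrightarrow> orbit_sum L f (of_bits (bs @ cs)) = orbit_sum L f (of_bits (cs @ bs))"
  by (metis orbit_sum_translate rotate_append translate_of_bits)


section \<open>Positivity of the weights\<close>

lemma gap_weight_pos:
  assumes "\<And>n. 0 < y (n + 1)"
  shows "0 < gap_weight y ns"
  using assms by (induction ns) (simp_all add: gap_weight_def)

lemma sum_gap_weight_pos: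
  assumes "\<And>n. 0 < y (n + 1)" "1 \<le> N"
  shows "0 < (\<Sum>ns\<in>gap_lists N K. gap_weight y ns)"
proof (rule sum_pos)
  \<comment> \<open>All empty sites are put behind the first particle.\<close>
  have "K # replicate (N - 1) 0 \<in> gap_lists N K"
    using assms by (simp add: gap_lists_def sum_list_replicate)
  then show "gap_lists N K \<noteq> {}" by blast
qed (use assms in \<open>auto simp: finite_gap_lists intro: gap_weight_pos\<close>)

lemma headway_weight_nonneg:
  assumes "\<And>n. 0 < y (n + 1)"
  shows "0 \<le> headway_weight y L \<eta>"
  unfolding headway_weight_def using assms by (intro prod_nonneg) (auto intro: less_imp_le)

text \<open>The third hypothesis trades the rate of the first particle for lowering its headway by
  one. Lists with head \<open>0\<close> drop out because \<open>r 0 = 0\<close>, and lowering the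
  head maps the others bijectively onto the lists with sum \<open>K\<close>.\<close>

lemma sum_gap_lists_shift_hd:
  assumes "r 0 = 0" "1 \<le> N" "\<And>n. r (Suc n) * y (n + 2) = w * y (n + 1)"
  shows "(\<Sum>ns\<in>gap_lists N (Suc K). gap_weight y ns * r (hd ns) * g ns)
    = w * (\<Sum>ns\<in>gap_lists N K. gap_weight y ns * g (Suc (hd ns) # tl ns))"
proof -
  have "(\<Sum>ns\<in>gap_lists N (Suc K). gap_weight y ns * r (hd ns) * g ns)
    = (\<Sum>ns\<in>{ns \<in> gap_lists N (Suc K). hd ns \<noteq> 0}. gap_weight y ns * r (hd ns) * g ns)"
    using assms by (intro sum.mono_neutral_right) (auto simp: finite_gap_lists)
  also have "\<dots> = (\<Sum>ns\<in>gap_lists N K. w * (gap_weight y ns * g (Suc (hd ns) # tl ns)))"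
  proof (rule sum.reindex_bij_witness[where i = "\<lambda>ns. Suc (hd ns) # tl ns" and j = "\<lambda>ns. (hd ns - 1) # tl ns"])
    fix ns assume *: "ns \<in> {ns \<in> gap_lists N (Suc K). hd ns \<noteq> 0}"
    then obtain n ms where ns: "ns = Suc n # ms"
      using assms by (cases ns; cases "hd ns") (auto simp: gap_lists_def)
    show "Suc (hd ((hd ns - 1) # tl ns)) # tl ((hd ns - 1) # tl ns) = ns"
      and "(hd ns - 1) # tl ns \<in> gap_lists N K"
      using * by (auto simp: gap_lists_def ns)
    have "gap_weight y ns * r (hd ns) = w * gap_weight y (n # ms)"
      using assms(3)[of n] by (simp add: ns gap_weight_Cons mult_ac)
    then show "w * (gap_weight y ((hd ns - 1) # tl ns) * g (Suc (hd ((hd ns - 1) # tl ns)) # tl ((hd ns - 1) # tl ns)))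
        = gap_weight y ns * r (hd ns) * g ns"
      by (simp add: ns)
  next
    fix ns assume "ns \<in> gap_lists N K"
    with assms show "(hd (Suc (hd ns) # tl ns) - 1) # tl (Suc (hd ns) # tl ns) = ns"
      and "Suc (hd ns) # tl ns \<in> {ns \<in> gap_lists N (Suc K). hd ns \<noteq> 0}"
      by (cases ns; auto simp: gap_lists_def)+
  qed
  finally show ?thesis by (simp add: sum_distrib_left)
qed

lemma sum_gap_lists_rotate1:
  "(\<Sum>ns\<in>gap_lists N K. g (rotate1 ns)) = (\<Sum>ns\<in>gap_lists N K. g ns)"
proof -
  have "inj_on rotate1 (gap_lists N K)"
    using inj_rotate1 by (rule inj_on_subset) simp
  moreover have "sum_list (rotate1 ns) = sum_list ns" for ns :: "nat list"
    by (cases ns) simp_all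
  then have "rotate1 ` gap_lists N K \<subseteq> gap_lists N K"
    by (auto simp: gap_lists_def)
  ultimately have "bij_betw rotate1 (gap_lists N K) (gap_lists N K)"
    by (intro bij_betw_imageI endo_inj_surj finite_gap_lists)
  then show ?thesis by (rule sum.reindex_bij_betw)
qed

text \<open>For \<open>x\<close> below \<open>L\<close>, \<open>L - x\<close> runs through
  \<open>1\<close> to \<open>L\<close> instead of \<open>0\<close> to \<open>L - 1\<close>; this is
  one extra translation, absorbed by the invariance of \<open>orbit_sum\<close>.\<close>

lemma sum_translate_diff: "(\<Sum>x<L. f (translate L (L - x) \<eta>)) = orbit_sum L f \<eta>"
proof -
  have "(\<Sum>x<L. f (translate L (L - x) \<eta>)) = (\<Sum>x<L. f (translate L (Suc (L - Suc x)) \<eta>))"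
    by (intro sum.cong) (auto simp: Suc_diff_Suc)
  also have "\<dots> = (\<Sum>x<L. f (translate L (Suc x) \<eta>))"
    by (rule sum.nat_diff_reindex[where g = "\<lambda>i. f (translate L (Suc i) \<eta>)"])
  also have "\<dots> = orbit_sum L f (translate L 1 \<eta>)"
    by (simp add: orbit_sum_def translate_translate)
  finally show ?thesis by (simp only: orbit_sum_translate)
qed

text \<open>Translating by \<open>x\<close> moves the jumping particle to \<open>0\<close> and
  leaves the inverse translation inside \<open>f\<close>; summing over \<open>x\<close> then gives
  the orbit sum. The map \<open>S\<close> is kept general to cover gain (an exchange) and loss (the
  identity) at once.\<close>

lemma sum_site_rate_orbit:
  assumes ext: "\<And>x \<eta>. x < L \<Longrightarrow> \<eta> \<in> configs L N \<Longrightarrow> S x \<eta> \<in> extensional {..<L}"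
    and covariant: "\<And>x \<eta>. x < L \<Longrightarrow> \<eta> \<in> configs L N \<Longrightarrow> S 0 (translate L x \<eta>) = translate L x (S x \<eta>)"
  shows "(\<Sum>x<L. \<Sum>\<eta>\<in>configs L N. headway_weight y L \<eta> * site_rate r L x \<eta> * f (S x \<eta>))
    = (\<Sum>\<eta>\<in>configs L N. headway_weight y L \<eta> * site_rate r L 0 \<eta> * orbit_sum L f (S 0 \<eta>))"
proof -
  let ?G = "\<lambda>x \<eta>. headway_weight y L \<eta> * site_rate r L 0 \<eta> * f (translate L (L - x) (S 0 \<eta>))"
  have "(\<Sum>x<L. \<Sum>\<eta>\<in>configs L N. headway_weight y L \<eta> * site_rate r L x \<eta> * f (S x \<eta>))
      = (\<Sum>x<L. \<Sum>\<eta>\<in>configs L N. ?G x \<eta>)"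
  proof (rule sum.cong[OF refl])
    fix x assume "x \<in> {..<L}"
    then have x: "x < L" by simp
    have "f (translate L (L - x) (S 0 (translate L x \<eta>))) = f (S x \<eta>)" if "\<eta> \<in> configs L N" for \<eta>
      using x that by (simp add: covariant translate_translate translate_L ext)
    then have "(\<Sum>\<eta>\<in>configs L N. headway_weight y L \<eta> * site_rate r L x \<eta> * f (S x \<eta>))
        = (\<Sum>\<eta>\<in>configs L N. ?G x (translate L x \<eta>))"
      using x by (simp add: headway_weight_translate site_rate_translate)
    also have "\<dots> = (\<Sum>\<eta>\<in>configs L N. ?G x \<eta>)"
      using x by (intro sum_configs_translate[where g = "?G x"]) simp
    finally show "(\<Sum>\<eta>\<in>configs L N. headway_weight y L \<eta> * site_rate r L x \<eta> * f (S x \<eta>))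
        = (\<Sum>\<eta>\<in>configs L N. ?G x \<eta>)" .
  qed
  also have "\<dots> = (\<Sum>\<eta>\<in>configs L N. \<Sum>x<L. ?G x \<eta>)"
    by (rule sum.swap)
  finally show ?thesis
    by (simp only: sum_distrib_left[symmetric] sum_translate_diff)
qed

text \<open>After the jump site \<open>0\<close> is empty and belongs, around the torus, to the
  headway of the last particle. Rotating the last block to the front shows its headway raised from
  \<open>k\<close> to \<open>Suc k\<close>.\<close>

lemma orbit_sum_exchange_gap_bits:
  assumes "ns @ [k] \<in> gap_lists N (L - N - 1)" "N < L" "m # ms = ns @ [k]"
  shows "orbit_sum L f (exchange 0 1 (of_bits (gap_bits (Suc m # ms))))
    = orbit_sum L f (of_bits (gap_bits (Suc k # ns)))"
proof -
  have "gap_bits (Suc m # ms) = 1 # 0 # replicate m 0 @ gap_bits ms"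
    by (simp add: gap_bits_Cons)
  then have "exchange 0 1 (of_bits (gap_bits (Suc m # ms))) = of_bits (0 # gap_bits (m # ms))"
    by (simp add: exchange_of_bits[simplified] gap_bits_Cons)
  also have "0 # gap_bits (m # ms) = (0 # gap_bits ns) @ (1 # replicate k 0)"
    by (simp add: assms(3) gap_bits_append gap_bits_Cons)
  finally have "orbit_sum L f (exchange 0 1 (of_bits (gap_bits (Suc m # ms))))
      = orbit_sum L f (of_bits ((0 # gap_bits ns) @ (1 # replicate k 0)))"
    by (rule arg_cong)
  also have "\<dots> = orbit_sum L f (of_bits ((1 # replicate k 0) @ (0 # gap_bits ns)))"
    using assms by (intro orbit_sum_of_bits) (auto simp: gap_lists_def length_gap_bits)
  also have "(1 # replicate k 0) @ (0 # gap_bits ns) = gap_bits (Suc k # ns)"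
    by (simp add: gap_bits_Cons replicate_app_Cons_same)
  finally show ?thesis .
qed

text \<open>Gain and loss at the particle at \<open>0\<close> match only in the sum over all gap lists, by \<open>rotate1\<close>.\<close>

lemma sum_site_rate_orbit_exchange:
  assumes "r 0 = 0" "\<And>n. r (Suc n) * y (n + 2) = w * y (n + 1)"
    and "1 \<le> N" "N < L"
  shows "(\<Sum>\<eta>\<in>configs L N. headway_weight y L \<eta> * site_rate r L 0 \<eta> * orbit_sum L f (exchange 0 1 \<eta>))
    = (\<Sum>\<eta>\<in>configs L N. headway_weight y L \<eta> * site_rate r L 0 \<eta> * orbit_sum L f \<eta>)"
proof -
  let ?K = "L - N - 1"
  have K: "L - N = Suc ?K" using assms by simp
  let ?h = "\<lambda>ns. gap_weight y ns * orbit_sum L f (exchange 0 1 (of_bits (gap_bits (Suc (hd ns) # tl ns))))"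
  \<comment> \<open>The head of \<open>ns\<close> is the last entry of \<open>rotate1 ns\<close>, so
    the headway raised by the jump is the one raised on the right-hand side.\<close>
  have "?h (rotate1 ns) = gap_weight y ns * orbit_sum L f (of_bits (gap_bits (Suc (hd ns) # tl ns)))"
    if ns_in: "ns \<in> gap_lists N ?K" for ns
  proof -
    obtain k ms where ns: "ns = k # ms"
      using ns_in assms by (cases ns) (auto simp: gap_lists_def)
    obtain m ms' where ms': "ms @ [k] = m # ms'"
      by (cases "ms @ [k]") auto
    have weight: "gap_weight y (rotate1 ns) = gap_weight y ns"
      by (simp add: ns gap_weight_def mult.commute)
    have "ms @ [k] \<in> gap_lists N ?K"
      using ns_in by (simp add: ns gap_lists_def)
    then have "orbit_sum L f (exchange 0 1 (of_bits (gap_bits (Suc m # ms'))))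
        = orbit_sum L f (of_bits (gap_bits (Suc k # ms)))"
      by (rule orbit_sum_exchange_gap_bits[OF _ \<open>N < L\<close> ms'[symmetric]])
    moreover have "rotate1 ns = m # ms'"
      by (simp only: ns rotate1.simps ms')
    ultimately show ?thesis
      using weight by (simp only: ns list.sel)
  qed
  then have "(\<Sum>ns\<in>gap_lists N ?K. ?h ns)
      = (\<Sum>ns\<in>gap_lists N ?K. gap_weight y ns * orbit_sum L f (of_bits (gap_bits (Suc (hd ns) # tl ns))))"
    unfolding sum_gap_lists_rotate1[of ?h, symmetric] by (rule sum.cong[OF refl])
  then have "(\<Sum>ns\<in>gap_lists N (Suc ?K). gap_weight y ns * r (hd ns) * orbit_sum L f (exchange 0 1 (of_bits (gap_bits ns))))
      = (\<Sum>ns\<in>gap_lists N (Suc ?K). gap_weight y ns * r (hd ns) * orbit_sum L f (of_bits (gap_bits ns)))"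
    by (simp only: sum_gap_lists_shift_hd[OF assms(1,3,2),
          where g = "\<lambda>ns. orbit_sum L f (exchange 0 1 (of_bits (gap_bits ns)))"]
        sum_gap_lists_shift_hd[OF assms(1,3,2),
          where g = "\<lambda>ns. orbit_sum L f (of_bits (gap_bits ns))"])
  then show ?thesis
    using assms(3,4) by (simp only: sum_configs_site_rate less_imp_le K[symmetric])
qed

section \<open>The two claims for general rates and weights\<close>

lemma Z_can_pos:
  assumes "\<And>n. 0 < y (n + 1)" "1 \<le> N" "N \<le> L"
  shows "0 < Z_can y L N"
proof -
  \<comment> \<open>Double counting reduces positivity to the sum over gap lists, all of whose terms
    are positive.\<close>
  have "0 < real N * Z_can y L N"
    unfolding N_times_Z_can[OF assms(2,3)]
    using assms by (intro mult_pos_pos sum_gap_weight_pos) auto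
  then show ?thesis by (simp add: zero_less_mult_iff)
qed

lemma mu_can_invariant:
  assumes "\<And>n. 0 < y (n + 1)" "r 0 = 0" "\<And>n. r (Suc n) * y (n + 2) = w * y (n + 1)"
    and "1 \<le> N" "N < L"
  shows "tahep_invariant r L N (mu_can y L N)"
  unfolding tahep_invariant_def
proof (intro conjI ballI allI)
  have Z: "0 < Z_can y L N"
    using assms by (intro Z_can_pos) auto
  show "0 \<le> mu_can y L N \<eta>" for \<eta>
    unfolding mu_can_def using Z assms(1) by (intro divide_nonneg_pos headway_weight_nonneg)
  show "(\<Sum>\<eta>\<in>configs L N. mu_can y L N \<eta>) = 1"
    using Z by (simp add: mu_can_def sum_divide_distrib[symmetric] Z_can_def[symmetric])
  fix f
  let ?S = "\<lambda>x. exchange x ((x + 1) mod L)"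
  let ?c = "\<lambda>x \<eta>. headway_weight y L \<eta> * site_rate r L x \<eta>"
  have L: "L \<ge> 2" using assms by simp
  have ext: "?S x \<eta> \<in> extensional {..<L}" if "x < L" "\<eta> \<in> configs L N" for x \<eta>
    using configs_extensional[OF that(2)] that(1) L by (auto simp: exchange_def extensional_def)
  have "expect L N (mu_can y L N) (tahep_generator r L f)
      = (\<Sum>\<eta>\<in>configs L N. \<Sum>x<L. ?c x \<eta> * f (?S x \<eta>) - ?c x \<eta> * f \<eta>) / Z_can y L N"
    by (simp add: expect_def mu_can_def tahep_generator_def sum_distrib_left sum_divide_distrib
        right_diff_distrib diff_divide_distrib mult.assoc)
  \<comment> \<open>The generator splits into gain and loss, each of which is moved to the bond at
    \<open>0\<close>.\<close>
  also have "(\<Sum>\<eta>\<in>configs L N. \<Sum>x<L. ?c x \<eta> * f (?S x \<eta>) - ?c x \<eta> * f \<eta>)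
      = (\<Sum>x<L. \<Sum>\<eta>\<in>configs L N. ?c x \<eta> * f (?S x \<eta>)) - (\<Sum>x<L. \<Sum>\<eta>\<in>configs L N. ?c x \<eta> * f \<eta>)"
    unfolding sum_subtractf by (intro arg_cong2[of _ _ _ _ "(-)"] sum.swap)
  also have "(\<Sum>x<L. \<Sum>\<eta>\<in>configs L N. ?c x \<eta> * f (?S x \<eta>))
      = (\<Sum>\<eta>\<in>configs L N. ?c 0 \<eta> * orbit_sum L f (exchange 0 1 \<eta>))"
    using sum_site_rate_orbit[where S = ?S and f = f and y = y and r = r and N = N and L = L] ext
      exchange_translate[OF L] L by simp
  also have "(\<Sum>x<L. \<Sum>\<eta>\<in>configs L N. ?c x \<eta> * f \<eta>)
      = (\<Sum>\<eta>\<in>configs L N. ?c 0 \<eta> * orbit_sum L f \<eta>)"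
    by (rule sum_site_rate_orbit[where S = "\<lambda>x \<eta>. \<eta>"]) (simp_all add: configs_extensional)
  finally show "expect L N (mu_can y L N) (tahep_generator r L f) = 0"
    using sum_site_rate_orbit_exchange[OF assms(2-5)] by simp
qed

lemma stationary_current_eq:
  assumes "\<And>n. 0 < y (n + 1)" "r 0 = 0" "\<And>n. r (Suc n) * y (n + 2) = w * y (n + 1)"
    and "1 \<le> N" "N < L" "x < L"
  shows "stationary_current r y L N x
    = w * (real N / real L) * (Z_tilde y N (L - N - 1) / Z_tilde y N (L - N))"
proof -
  define A where "A K = (\<Sum>ns\<in>gap_lists N K. gap_weight y ns)" for K
  have K: "L - N = Suc (L - N - 1)" using assms by simp
  have "stationary_current r y L N x
      = (\<Sum>\<eta>\<in>configs L N. headway_weight y L \<eta> * site_rate r L x \<eta>) / Z_can y L N"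
    using assms
    by (simp add: stationary_current_def expect_def mu_can_def inst_current_eq sum_divide_distrib)
  also have "(\<Sum>\<eta>\<in>configs L N. headway_weight y L \<eta> * site_rate r L x \<eta>)
      = (\<Sum>ns\<in>gap_lists N (Suc (L - N - 1)). gap_weight y ns * r (hd ns) * 1)"
    using sum_configs_site_rate[of N L y r "\<lambda>_. 1"] assms(4,5)
    by (simp only: sum_configs_site_rate_eq_0[OF assms(6)] K[symmetric] mult_1_right less_imp_le)
  also have "\<dots> = w * A (L - N - 1)"
    unfolding sum_gap_lists_shift_hd[OF assms(2,4,3), where g = "\<lambda>_. 1"]
    by (simp only: A_def mult_1_right)
  \<comment> \<open>Double counting of particles is the source of the factor
    \<open>N / L\<close>.\<close>
  also have "Z_can y L N = real L * A (L - N) / real N"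
    using N_times_Z_can[of N L y] assms(4,5) by (simp add: A_def eq_divide_eq mult.commute)
  finally have current: "stationary_current r y L N x = w * A (L - N - 1) / (real L * A (L - N) / real N)" .
  have "y 1 ^ N \<noteq> 0" using assms(1)[of 0] by simp
  then have "Z_tilde y N (L - N - 1) / Z_tilde y N (L - N) = A (L - N - 1) / A (L - N)"
    unfolding Z_tilde_eq A_def[symmetric] by simp
  then show ?thesis
    by (simp add: current)
qed

theorem proposition3p10:
  fixes J :: "nat \<Rightarrow> ereal" and w :: real and L N :: nat
  assumes "J 0 = \<infinity>" and "\<And>k. k \<ge> 1 \<Longrightarrow> \<bar>J k\<bar> \<noteq> \<infinity>"
    and "L \<ge> 2" and "1 \<le> N" and "N \<le> L - 1" and "w > 0"
  shows "tahep_invariant (jump_rate J w) L N (mu_can (boltzmann J) L N) \<and>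
    (\<forall>x<L. stationary_current (jump_rate J w) (boltzmann J) L N x =
      w * (real N / real L) *
        (Z_tilde (boltzmann J) N (L - N - 1) / Z_tilde (boltzmann J) N (L - N)))"
proof -
  have y: "boltzmann J (n + 1) = exp (- real_of_ereal (J (n + 1)))" for n
    using assms(2)[of "n + 1"] by (auto simp: boltzmann_def)
  have pos: "0 < boltzmann J (n + 1)" for n
    by (simp only: y exp_gt_zero)
  have r0: "jump_rate J w 0 = 0" by (simp add: jump_rate_def)
  \<comment> \<open>The identity \<open>w\<^sub>n y\<^sub>n\<^sub>+\<^sub>1 = w y\<^sub>n\<close> at
    \<open>Suc n\<close>: the Boltzmann factor cancels one of the two terms in the exponent of the
    rate.\<close>
  have rate: "jump_rate J w (Suc n) * boltzmann J (n + 2) = w * boltzmann J (n + 1)" for n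
  proof -
    \<comment> \<open>Both indices are at least \<open>1\<close>, so the values are finite and the
      conversion commutes with subtraction.\<close>
    have "real_of_ereal (J (n + 2) - J (n + 1)) = real_of_ereal (J (n + 2)) - real_of_ereal (J (n + 1))"
      using assms(2)[of "n + 1"] assms(2)[of "n + 2"] by (cases "J (n + 1)"; cases "J (n + 2)") auto
    then show ?thesis
      using y[of "n + 1"] y[of n] by (simp add: jump_rate_def flip: exp_add)
  qed
  have "N < L" using assms by simp
  then show ?thesis
    using mu_can_invariant[of "boltzmann J" "jump_rate J w" w N L, OF pos r0 rate assms(4)]
      stationary_current_eq[of "boltzmann J" "jump_rate J w" w N L, OF pos r0 rate assms(4)]
    by simp
qed

end
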